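(* Let $X$ be a max-stable random field on a set $T$ with standard Fréchet marginals and extremal coefficient function $\theta$. Let $M\subset T$ be finite and non-empty and let $\mathcal K_M\subset[0,\infty)^M$ be the dependency set of $\{X_t\}_{t\in M}$. For $\emptyset\ne L\subset M$ let $\mathbf 1^M_L\in\mathbb R^M$ be the indicator function of $L$ and $$\mathcal H_L:=\{x\in[0,\infty)^M:\langle x,\mathbf 1^M_L\rangle\le\theta(L)\}.$$ a) Then $\mathcal K_M\subset\bigcap_{\emptyset\ne L\subset M}\mathcal H_L$. b) For each $\emptyset\neq L\subset M$ there exists a point $x^L\in\mathcal K_M$ lying on the bounding plane of $\mathcal H_L$, i.e. $\langle x^L,\mathbf 1^M_L\rangle=\theta(L)$. c) Let $X^*$ be the max-linear max-stable random field associated with $\theta$ (see context). The dependency set $\mathcal K^*_M$ of $\{X^*_t\}_{t\in M}$ is $\mathcal K^*_M=\bigcap_{\emptyset\neq L\subset M}\mathcal H_L$.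
   Context: A random field $X=\{X_t\}_{t\in T}$ has standard Fréchet marginals if $\mathbb P(X_t\le x)=e^{-1/x}$ for all $t\in T$, $x\ge 0$ (value $0$ at $x=0$). Such a field is max-stable if for every $n\ge1$ and independent copies $X^{(1)},\dots,X^{(n)}$ of $X$ the field $n^{-1}\max_{i}X^{(i)}$ has the same (finite-dimensional) distributions as $X$. $\mathcal F(T)$ denotes the set of finite subsets of $T$. The extremal coefficient function is $\theta:\mathcal F(T)\to[0,\infty)$, $\theta(\emptyset):=0$, $\theta(M):=-x\log\mathbb P(\max_{t\in M}X_t\le x)$ for non-empty finite $M$ and any $x\in(0,\infty)$ (independent of $x$). For finite non-empty $M\subset T$, $\mathbb R^M$ carries the standard scalar product $\langle x,y\rangle=\sum_{t\in M}x_ty_t$. The stable tail dependence function of $\{X_t\}_{t\in M}$ is $\ell_M(x):=-\log\mathbb P(X_t\le 1/x_t,\ t\in M)$, $x\in[0,\infty)^M$ (with $1/0:=\infty$). The dependency set $\mathcal K_M$ is the compact convex set $\mathcal K_M\subset[0,\infty)^M$ with $\ell_M(x)=\sup\{\langle x,y\rangle:y\in\mathcal K_M\}$ for all $0\ne x\in[0,\infty)^M$, namely the largest such set: $$\mathcal K_M=\{y\in[0,\infty)^M:\langle x,y\rangle\le\ell_M(x)\text{ for all }x\in[0,\infty)^M\}.$$ The field $X^*=\{X^*_t\}_{t\in T}$ associated with $\theta$ is the random field with finite-dimensional distributions $$-\log\mathbb P(X^*_t\le x_t,\ t\in M)=\sum_{\emptyset\neq L\subset M}\tau^M_L\max_{t\in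 L}\frac1{x_t},\qquad \tau^M_L:=\sum_{I\subset L}(-1)^{|I|+1}\theta\big((M\setminus L)\cup I\big),$$ for non-empty finite $M\subset T$. It is well defined (in particular $\tau^M_L\ge0$), max-stable with standard Fréchet marginals, and has extremal coefficient function $\theta$. *)

theory Defs
  imports "HOL-Probability.Probability"
begin

definition random_field :: "'w measure \<Rightarrow> 't set \<Rightarrow> ('t \<Rightarrow> 'w \<Rightarrow> real) \<Rightarrow> bool" where
  "random_field P T X \<longleftrightarrow> prob_space P \<and> (\<forall>t\<in>T. X t \<in> borel_measurable P)"

definition same_fdd ::
    "'t set \<Rightarrow> 'v measure \<Rightarrow> ('t \<Rightarrow> 'v \<Rightarrow> real) \<Rightarrow> 'w measure \<Rightarrow> ('t \<Rightarrow> 'w \<Rightarrow> real) \<Rightarrow> bool" where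
  "same_fdd T Q Y P X \<longleftrightarrow>
     (\<forall>F. finite F \<and> F \<subseteq> T \<longrightarrow>
        distr Q (PiM F (\<lambda>_. borel)) (\<lambda>\<omega>. \<lambda>t\<in>F. Y t \<omega>) =
        distr P (PiM F (\<lambda>_. borel)) (\<lambda>\<omega>. \<lambda>t\<in>F. X t \<omega>))"

definition standard_frechet_marginals ::
    "'w measure \<Rightarrow> 't set \<Rightarrow> ('t \<Rightarrow> 'w \<Rightarrow> real) \<Rightarrow> bool" where
  "standard_frechet_marginals P T X \<longleftrightarrow>
     (\<forall>t\<in>T. \<forall>x\<ge>0. measure P {\<omega> \<in> space P. X t \<omega> \<le> x} = (if x = 0 then 0 else exp (- 1 / x)))"

definition independent_copies ::
    "'w measure \<Rightarrow> 't set \<Rightarrow> ('t \<Rightarrow> 'w \<Rightarrow> real) \<Rightarrow> nat \<Rightarrow>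
     'v measure \<Rightarrow> (nat \<Rightarrow> 't \<Rightarrow> 'v \<Rightarrow> real) \<Rightarrow> bool" where
  "independent_copies P T X n Q Y \<longleftrightarrow>
     (\<forall>i<n. random_field Q T (Y i) \<and> same_fdd T Q (Y i) P X) \<and>
     prob_space.indep_vars Q (\<lambda>_. PiM T (\<lambda>_. borel)) (\<lambda>i \<omega>. \<lambda>t\<in>T. Y i t \<omega>) {..<n}"

text \<open>
  A definition cannot quantify over the type of the sample space carrying the copies. The type
  \<^typ>\<open>nat \<Rightarrow> 'w\<close> carries the product of \<open>n\<close> copies of \<open>P\<close>, hence some choice of independent copies, and
  the condition depends only on the law of the copies, so nothing is lost by fixing this type.
\<close>

definition max_stable :: "'w measure \<Rightarrow> 't set \<Rightarrow> ('t \<Rightarrow> 'w \<Rightarrow> real) \<Rightarrow> bool" where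
  "max_stable P T X \<longleftrightarrow>
     (\<forall>n\<ge>1. \<forall>(Q :: (nat \<Rightarrow> 'w) measure) Y. independent_copies P T X n Q Y \<longrightarrow>
        same_fdd T Q (\<lambda>t \<omega>. (MAX i\<in>{..<n}. Y i t \<omega>) / real n) P X)"

text \<open>
  The threshold \<open>1\<close> is immaterial for max-stable fields: see \<open>extremal_coeff_eq\<close> below. Only finite
  arguments are meaningful.
\<close>

definition extremal_coeff :: "'w measure \<Rightarrow> ('t \<Rightarrow> 'w \<Rightarrow> real) \<Rightarrow> 't set \<Rightarrow> real" where
  "extremal_coeff P X M =
     (if M = {} then 0 else - ln (measure P {\<omega> \<in> space P. (MAX t\<in>M. X t \<omega>) \<le> 1}))"

text \<open>
  Vectors in \<open>\<real>\<^sup>M\<close> are represented by functions in \<^term>\<open>M \<rightarrow>\<^sub>E (UNIV :: real set)\<close>.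
\<close>

definition scalar_prod :: "'t set \<Rightarrow> ('t \<Rightarrow> real) \<Rightarrow> ('t \<Rightarrow> real) \<Rightarrow> real" where
  "scalar_prod M x y = (\<Sum>t\<in>M. x t * y t)"

definition indicator_vec :: "'t set \<Rightarrow> 't set \<Rightarrow> 't \<Rightarrow> real" where
  "indicator_vec M L = (\<lambda>t\<in>M. indicator L t)"

text \<open>The disjunct \<open>x t = 0\<close> is the convention \<open>1/0 = \<infinity>\<close>.\<close>

definition stable_tail_dependence ::
    "'w measure \<Rightarrow> ('t \<Rightarrow> 'w \<Rightarrow> real) \<Rightarrow> 't set \<Rightarrow> ('t \<Rightarrow> real) \<Rightarrow> real" where
  "stable_tail_dependence P X M x =
     - ln (measure P {\<omega> \<in> space P. \<forall>t\<in>M. x t = 0 \<or> X t \<omega> \<le> 1 / x t})"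

definition dependency_set :: "'w measure \<Rightarrow> ('t \<Rightarrow> 'w \<Rightarrow> real) \<Rightarrow> 't set \<Rightarrow> ('t \<Rightarrow> real) set" where
  "dependency_set P X M =
     {y \<in> M \<rightarrow>\<^sub>E {0..}. \<forall>x \<in> M \<rightarrow>\<^sub>E {0..}. scalar_prod M x y \<le> stable_tail_dependence P X M x}"

definition half_space :: "('t set \<Rightarrow> real) \<Rightarrow> 't set \<Rightarrow> 't set \<Rightarrow> ('t \<Rightarrow> real) set" where
  "half_space \<theta> M L = {x \<in> M \<rightarrow>\<^sub>E {0..}. scalar_prod M x (indicator_vec M L) \<le> \<theta> L}"

definition tau :: "('t set \<Rightarrow> real) \<Rightarrow> 't set \<Rightarrow> 't set \<Rightarrow> real" where
  "tau \<theta> M L = (\<Sum>I\<in>Pow L. (- 1) ^ (card I + 1) * \<theta> ((M - L) \<union> I))"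

text \<open>
  The distribution function is given in exponentiated form, because \<^term>\<open>ln 0 = (0::real)\<close> would
  make \<open>- ln\<close> of a null event look finite. Levels \<open>x t > 0\<close> suffice: letting them tend to \<open>0\<close>
  shows that the field is almost surely positive at each index.
\<close>

definition associated_field ::
    "('t set \<Rightarrow> real) \<Rightarrow> 'w measure \<Rightarrow> 't set \<Rightarrow> ('t \<Rightarrow> 'w \<Rightarrow> real) \<Rightarrow> bool" where
  "associated_field \<theta> P T X \<longleftrightarrow> random_field P T X \<and>
     (\<forall>M x. finite M \<and> M \<noteq> {} \<and> M \<subseteq> T \<and> (\<forall>t\<in>M. 0 < x t) \<longrightarrow>
        measure P {\<omega> \<in> space P. \<forall>t\<in>M. X t \<omega> \<le> x t} =
        exp (- (\<Sum>L\<in>Pow M - {{}}. tau \<theta> M L * (MAX t\<in>L. 1 / x t))))"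


lemma canonical_copies:
  assumes rf: "random_field P T X" and n: "n \<ge> 1"
  shows "independent_copies P T X n (PiM {..<n} (\<lambda>_. P)) (\<lambda>i t \<omega>. X t (\<omega> i))"
proof -
  let ?R = "PiM {..<n} (\<lambda>_. P)"
  interpret P: prob_space P using rf by (simp add: random_field_def)
  have pR: "prob_space ?R" by (rule prob_space_PiM) (rule P.prob_space_axioms)
  interpret R: prob_space ?R by (rule pR)
  have X[measurable]: "X t \<in> borel_measurable P" if "t \<in> T" for t
    using rf that by (simp add: random_field_def)
  have comp: "distr ?R P (\<lambda>\<omega>. \<omega> i) = P" if "i < n" for i
    using distr_PiM_component[of "{..<n}" "\<lambda>_. P" i] that P.prob_space_axioms by auto
  have field: "(\<lambda>w. \<lambda>t\<in>F. X t w) \<in> P \<rightarrow>\<^sub>M PiM F (\<lambda>_. borel)" if "F \<subseteq> T" for F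
    using that by (intro measurable_restrict X) auto
  have coord: "(\<lambda>\<omega>. \<omega> i) \<in> ?R \<rightarrow>\<^sub>M P" if "i < n" for i
    using that by (intro measurable_component_singleton) auto
  have 1: "random_field ?R T (\<lambda>t \<omega>. X t (\<omega> i))" if "i < n" for i
    using pR measurable_compose[OF coord[OF that] X] by (auto simp: random_field_def)
  have 2: "same_fdd T ?R (\<lambda>t \<omega>. X t (\<omega> i)) P X" if "i < n" for i
    unfolding same_fdd_def
  proof (intro allI impI)
    fix F assume F: "finite F \<and> F \<subseteq> T"
    have "distr P (PiM F (\<lambda>_. borel)) (\<lambda>\<omega>. \<lambda>t\<in>F. X t \<omega>)
        = distr (distr ?R P (\<lambda>\<omega>. \<omega> i)) (PiM F (\<lambda>_. borel)) (\<lambda>\<omega>. \<lambda>t\<in>F. X t \<omega>)"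
      using comp[OF that] by simp
    also have "\<dots> = distr ?R (PiM F (\<lambda>_. borel)) (\<lambda>\<omega>. \<lambda>t\<in>F. X t (\<omega> i))"
      using F by (subst distr_distr[OF field coord[OF that]]) (auto simp: comp_def)
    finally show "distr ?R (PiM F (\<lambda>_. borel)) (\<lambda>\<omega>. \<lambda>t\<in>F. X t (\<omega> i))
        = distr P (PiM F (\<lambda>_. borel)) (\<lambda>\<omega>. \<lambda>t\<in>F. X t \<omega>)" by simp
  qed
  have "R.indep_vars (\<lambda>_. P) (\<lambda>i \<omega>. \<omega> i) {..<n}"
  proof (subst R.indep_vars_iff_distr_eq_PiM')
    show "{..<n} \<noteq> {}" using n by (auto simp: lessThan_empty_iff)
    show "\<And>i. i \<in> {..<n} \<Longrightarrow> (\<lambda>\<omega>. \<omega> i) \<in> ?R \<rightarrow>\<^sub>M P" using coord by auto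
    have "distr ?R ?R (\<lambda>x. \<lambda>i\<in>{..<n}. x i) = distr ?R ?R (\<lambda>x. x)"
      by (intro distr_cong) (auto simp: space_PiM PiE_restrict)
    also have "\<dots> = ?R" by simp
    also have "\<dots> = PiM {..<n} (\<lambda>i. distr ?R P (\<lambda>\<omega>. \<omega> i))"
      by (intro PiM_cong) (auto simp: comp)
    finally show "distr ?R ?R (\<lambda>x. \<lambda>i\<in>{..<n}. x i)
        = PiM {..<n} (\<lambda>i. distr ?R P (\<lambda>\<omega>. \<omega> i))" .
  qed
  then have "R.indep_vars (\<lambda>_. PiM T (\<lambda>_. borel)) (\<lambda>i \<omega>. \<lambda>t\<in>T. X t (\<omega> i)) {..<n}"
    by (rule R.indep_vars_compose2[where X="\<lambda>i \<omega>. \<omega> i"]) (rule field, simp)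
  with 1 2 show ?thesis by (simp add: independent_copies_def)
qed

lemma prob_le_distr:
  assumes "random_field R T Z" "finite F" "F \<subseteq> T"
  shows "measure R {\<omega> \<in> space R. \<forall>t\<in>F. Z t \<omega> \<le> x t}
      = measure (distr R (PiM F (\<lambda>_. borel)) (\<lambda>\<omega>. \<lambda>t\<in>F. Z t \<omega>)) (PiE F (\<lambda>t. {..x t}))"
proof -
  let ?B = "PiM F (\<lambda>_. borel :: real measure)"
  have S: "PiE F (\<lambda>t. {..x t}) \<in> sets ?B"
    using assms(2) by (intro sets_PiM_I_finite) auto
  have "(\<lambda>\<omega>. \<lambda>t\<in>F. Z t \<omega>) \<in> R \<rightarrow>\<^sub>M ?B"
    using assms by (intro measurable_restrict) (auto simp: random_field_def)
  from measure_distr[OF this S] show ?thesis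
    by (auto intro!: arg_cong[where f="measure R"] simp: PiE_iff)
qed

lemma max_stable_prob_le:
  assumes rf: "random_field P T X" and ms: "max_stable P T X"
    and F: "finite F" "F \<subseteq> T" and n: "n \<ge> 1"
  shows "measure P {\<omega> \<in> space P. \<forall>t\<in>F. X t \<omega> \<le> x t}
       = measure P {\<omega> \<in> space P. \<forall>t\<in>F. X t \<omega> \<le> real n * x t} ^ n"
proof -
  let ?R = "PiM {..<n} (\<lambda>_. P)"
  let ?Y = "\<lambda>i t \<omega>. X t (\<omega> i)"
  let ?Z = "\<lambda>t \<omega>. (MAX i\<in>{..<n}. ?Y i t \<omega>) / real n"
  let ?A = "{w \<in> space P. \<forall>t\<in>F. X t w \<le> real n * x t}"
  interpret P: prob_space P using rf by (simp add: random_field_def)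
  interpret R: finite_product_prob_space "\<lambda>_. P" "{..<n}"
    by standard auto
  have ic: "independent_copies P T X n ?R ?Y"
    by (rule canonical_copies[OF rf n])
  then have fdd: "same_fdd T ?R ?Z P X"
    using ms n unfolding max_stable_def by blast
  have ne: "{..<n} \<noteq> {}" using n by (auto simp: lessThan_empty_iff)
  have rfZ: "random_field ?R T ?Z"
    using ic ne by (auto simp: random_field_def independent_copies_def R.prob_space_axioms
        intro!: borel_measurable_divide borel_measurable_Max)
  have A: "?A \<in> sets P"
    using F rf by (auto simp: random_field_def intro!: sets.sets_Collect_finite_All borel_measurable_le)
  have "measure P {\<omega> \<in> space P. \<forall>t\<in>F. X t \<omega> \<le> x t}
      = measure ?R {\<omega> \<in> space ?R. \<forall>t\<in>F. ?Z t \<omega> \<le> x t}"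
    using fdd F by (simp add: prob_le_distr[OF rf F] prob_le_distr[OF rfZ F] same_fdd_def)
  also have "{\<omega> \<in> space ?R. \<forall>t\<in>F. ?Z t \<omega> \<le> x t} = PiE {..<n} (\<lambda>_. ?A)"
    using n ne by (auto simp: space_PiM PiE_iff divide_le_eq mult.commute extensional_def)
  also have "measure ?R \<dots> = measure P ?A ^ n"
    using R.prob_times[of "\<lambda>_. ?A"] A by simp
  finally show ?thesis .
qed

lemma extremal_coeff_eq:
  assumes rf: "random_field P T X" and ms: "max_stable P T X"
    and M: "finite M" "M \<noteq> {}" "M \<subseteq> T" and x: "x > 0"
  shows "extremal_coeff P X M = - x * ln (measure P {\<omega> \<in> space P. (MAX t\<in>M. X t \<omega>) \<le> x})"
proof -
  interpret P: prob_space P using rf by (simp add: random_field_def)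
  define p where "p x = measure P {\<omega> \<in> space P. \<forall>t\<in>M. X t \<omega> \<le> x}" for x
  define g where "g x = - ln (p x)" for x
  define h where "h x = x * g x" for x
  have sets: "{\<omega> \<in> space P. \<forall>t\<in>M. X t \<omega> \<le> x} \<in> sets P" for x
    using M rf by (auto simp: random_field_def intro!: sets.sets_Collect_finite_All borel_measurable_le)
  have p_mono: "p x \<le> p y" if "x \<le> y" for x y
    unfolding p_def using that by (intro P.finite_measure_mono sets) force
  have p01: "0 \<le> p x" "p x \<le> 1" for x by (auto simp: p_def)
  have p_pow: "p x = p (real n * x) ^ n" if "n \<ge> 1" for n x
    using max_stable_prob_le[OF rf ms M(1) M(3) that, of "\<lambda>_. x"] by (simp add: p_def)
  have p_zero: "p z = 0" if y: "y > 0" "p y = 0" for y z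
  proof -
    obtain n where n: "real n * y > z" using y(1) reals_Archimedean3 by blast
    have "p z \<le> p (real (Suc n) * y)"
      using n y(1) by (intro p_mono) (auto simp: algebra_simps)
    also have "\<dots> = 0" using p_pow[of "Suc n" y] y(2) by (metis One_nat_def Suc_leI power_not_zero zero_less_Suc)
    finally show ?thesis using p01(1)[of z] by simp
  qed
  have g_nonneg: "g x \<ge> 0" for x
    using p01[of x] by (cases "p x = 0") (auto simp: g_def)
  have g_anti: "g y \<le> g x" if "0 < x" "x \<le> y" for x y
  proof (cases "p x = 0")
    case True
    then show ?thesis using p_zero[of x y] that by (simp add: g_def)
  next
    case False
    then show ?thesis using p_mono[OF that(2)] p01[of x] by (simp add: g_def)
  qed
  have h_nat: "h (real n * x) = h x" if "n \<ge> 1" for n x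
  proof -
    have "ln (p x) = real n * ln (p (real n * x))"
      using p_pow[OF that, of x] p01(1)[of "real n * x"] that
      by (cases "p (real n * x) = 0") (simp_all add: ln_realpow power_0_left)
    then show ?thesis by (simp add: h_def g_def)
  qed
  have h_rat: "h (q * x) = h x" if "q \<in> \<rat>" "q > 0" for q x
  proof -
    from \<open>q \<in> \<rat>\<close> obtain a b :: nat where ab: "b \<noteq> 0" "\<bar>q\<bar> = real a / real b"
      by (rule Rats_abs_nat_div_natE)
    with that(2) have "a \<noteq> 0" "q = real a / real b"
      by (cases "a = 0"; simp)+
    then have "h (q * x) = h (real b * (q * x))" using ab h_nat[of b "q * x"] by linarith
    also have "\<dots> = h (real a * x)" using ab \<open>q = _\<close> by simp
    also have "\<dots> = h x" using h_nat[of a] \<open>a \<noteq> 0\<close> by simp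
    finally show ?thesis .
  qed
  have h_le: "h x \<le> h y" if xy: "x > 0" "y > 0" for x y
  proof (rule ccontr)
    assume "\<not> h x \<le> h y"
    then have less: "y * g y < h x" by (simp add: h_def)
    have bound: "h x \<le> q * x * g y" if q: "q \<in> \<rat>" "q > y / x" for q
    proof -
      have "y / x > 0" using xy by simp
      then have q0: "q > 0" using q(2) by linarith
      have "y \<le> q * x" using q(2) xy by (simp add: field_simps)
      then have "q * x * g (q * x) \<le> q * x * g y"
        using g_anti[of y "q * x"] xy q0 by (intro mult_left_mono) auto
      then show ?thesis using h_rat[OF q(1) q0, of x] by (simp only: h_def)
    qed
    show False
    proof (cases "g y = 0")
      case True
      obtain q where "q \<in> \<rat>" "y / x < q" using Rats_dense_in_real[of "y / x" "y / x + 1"] by auto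
      then show False using bound[of q] less True by simp
    next
      case False
      then have gy: "g y > 0" using g_nonneg[of y] by simp
      then have "y / x < h x / (x * g y)" using less xy by (simp add: field_simps)
      then obtain q where q: "q \<in> \<rat>" "y / x < q" "q < h x / (x * g y)"
        using Rats_dense_in_real by blast
      then have "q * x * g y < h x" using gy xy by (simp add: field_simps)
      then show False using bound[OF q(1,2)] by simp
    qed
  qed
  have "h 1 = h x" using h_le[of 1 x] h_le[of x 1] x by simp
  moreover have "p z = measure P {\<omega> \<in> space P. (MAX t\<in>M. X t \<omega>) \<le> z}" for z
    using M by (simp add: p_def)
  ultimately show ?thesis using M(2) by (simp add: extremal_coeff_def h_def g_def)
qed

end

theory Submission
  imports Defs
begin

text \<open>
  On the closed orthant, the stable tail dependence function of \<open>X\<^sup>*\<close> is the Choquet integral of its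
  argument with respect to \<open>\<theta>\<close>: by Moebius inversion, the \<open>\<tau>\<close>-mass of the sets meeting \<open>A\<close> is \<open>\<theta> A\<close>.
  A non-negative vector is a positive combination of indicator vectors along a chain, so the
  half space inequalities add up to all the inequalities that define the dependency set.

  For a general field and a set \<open>L\<close>, a point of the dependency set on the bounding plane is a limit of
  explicit ones. The variable \<open>max\<^sub>t u\<^sub>t X\<^sub>t\<close> has the law of \<open>\<ell> u\<close> times a standard Frechet variable \<open>Z\<close>,
  hence its \<open>a\<close>-th moment is \<open>(\<ell> u)\<^sup>a E Z\<^sup>a\<close> for \<open>0 < a < 1\<close>. Let \<open>y\<^sub>t = E (w\<^sub>t X\<^sub>t\<^sup>a) / E Z\<^sup>a\<close>, where \<open>w\<close>
  spreads unit mass evenly over the maximizers of \<open>X\<close> on \<open>L\<close>. Then the entries of \<open>y\<close> sum up to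
  \<open>(\<theta> L)\<^sup>a\<close>, and \<open>\<langle>u, y\<rangle> \<le> C\<^sup>1\<^sup>-\<^sup>a (\<ell> u)\<^sup>a\<close> whenever \<open>u \<le> C\<close>. Letting \<open>a\<close> tend to \<open>1\<close>, an accumulation
  point of these \<open>y\<close> is as desired. This avoids both the spectral representation and convexity of \<open>\<ell>\<close>.
\<close>

section \<open>Moebius inversion and max-linear fields\<close>

lemma sum_tau_Pow:
  assumes "finite M" "B \<subseteq> M"
  shows "(\<Sum>L\<in>Pow B. tau \<theta> M L) = - \<theta> (M - B)"
proof -
  define g where "g L = (\<Sum>J\<in>Pow L. (- 1) ^ card J * \<theta> (M - J))" for L
  have g: "(- 1) ^ card L * g L = - tau \<theta> M L" if "L \<subseteq> M" for L
  proof -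
    have fin: "finite L" using that assms(1) finite_subset by blast
    have "tau \<theta> M L = (\<Sum>J\<in>Pow L. (- 1) ^ (card (L - J) + 1) * \<theta> ((M - L) \<union> (L - J)))"
      unfolding tau_def by (rule sum.reindex_bij_witness[of _ "\<lambda>J. L - J" "\<lambda>J. L - J"]) (auto simp: double_diff)
    also have "\<dots> = (\<Sum>J\<in>Pow L. - ((- 1) ^ card L * ((- 1) ^ card J * \<theta> (M - J))))"
    proof (rule sum.cong)
      fix J assume "J \<in> Pow L"
      then have J: "J \<subseteq> L" by simp
      then have "(M - L) \<union> (L - J) = M - J" using that by blast
      moreover have "card L = card (L - J) + card J"
        using J fin by (metis card_Diff_subset card_mono finite_subset le_add_diff_inverse2)
      ultimately show "(- 1) ^ (card (L - J) + 1) * \<theta> ((M - L) \<union> (L - J)) =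
          - ((- 1) ^ card L * ((- 1) ^ card J * \<theta> (M - J)))"
        by (simp add: power_add flip: power_mult_distrib)
    qed simp
    finally show ?thesis by (simp add: g_def sum_negf sum_distrib_left)
  qed
  have fB: "finite B" using assms finite_subset by blast
  have "\<theta> (M - B) = (\<Sum>L\<in>Pow B. (- 1) ^ card L * g L)"
    by (rule inclusion_exclusion_symmetric[where f="\<lambda>J. \<theta> (M - J)", OF _ fB]) (simp add: g_def)
  also have "\<dots> = (\<Sum>L\<in>Pow B. - tau \<theta> M L)"
    using g assms(2) by (intro sum.cong) auto
  finally show ?thesis by (simp add: sum_negf)
qed

lemma sum_tau_meeting:
  assumes "finite M" "A \<subseteq> M" "\<theta> {} = 0"
  shows "(\<Sum>L\<in>Pow M - {{}}. tau \<theta> M L * (if L \<inter> A \<noteq> {} then 1 else 0)) = \<theta> A"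
proof -
  have "(\<Sum>L\<in>Pow M - {{}}. tau \<theta> M L * (if L \<inter> A \<noteq> {} then 1 else 0))
      = (\<Sum>L\<in>Pow M - Pow (M - A). tau \<theta> M L)"
    using assms(1) by (intro sum.mono_neutral_cong_right) auto
  also have "\<dots> = (\<Sum>L\<in>Pow M. tau \<theta> M L) - (\<Sum>L\<in>Pow (M - A). tau \<theta> M L)"
    using assms(1) by (intro sum_diff) auto
  also have "\<dots> = \<theta> A"
    using assms by (simp add: sum_tau_Pow double_diff)
  finally show ?thesis .
qed

text \<open>Peeling off the smallest positive level of \<open>x\<close> decomposes \<open>x\<close> along a chain of indicator vectors.\<close>

lemma sum_le_tau_sum:
  fixes x y :: "'t \<Rightarrow> real"
  assumes M: "finite M" and \<theta>: "\<theta> {} = 0"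
    and y: "\<And>L. L \<subseteq> M \<Longrightarrow> L \<noteq> {} \<Longrightarrow> (\<Sum>t\<in>L. y t) \<le> \<theta> L"
    and x: "\<And>t. t \<in> M \<Longrightarrow> 0 \<le> x t"
  shows "(\<Sum>t\<in>M. x t * y t) \<le> (\<Sum>L\<in>Pow M - {{}}. tau \<theta> M L * (MAX t\<in>L. x t))"
  using x
proof (induction "card {t\<in>M. x t > 0}" arbitrary: x rule: less_induct)
  case less
  define A where "A = {t\<in>M. x t > 0}"
  have A: "A \<subseteq> M" "finite A" using M by (auto simp: A_def)
  have fin: "finite L" "L \<noteq> {}" "L \<subseteq> M" if "L \<in> Pow M - {{}}" for L
    using that M finite_subset by auto
  show ?case
  proof (cases "A = {}")
    case True
    then have x0: "x t = 0" if "t \<in> M" for t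
      using less.prems[OF that] that by (force simp: A_def)
    have "(MAX t\<in>L. x t) = 0" if "L \<in> Pow M - {{}}" for L
    proof -
      have "x ` L = {0}" using fin[OF that] x0 by force
      then show ?thesis by simp
    qed
    then show ?thesis using x0 by simp
  next
    case False
    define m where "m = (MIN t\<in>A. x t)"
    have m_le: "m \<le> x t" if "t \<in> A" for t using that A by (simp add: m_def)
    obtain s where s: "s \<in> A" "x s = m"
    proof -
      have "m \<in> x ` A" unfolding m_def using A False by (intro Min_in) auto
      then show ?thesis using that by auto
    qed
    have m: "m > 0" using s by (auto simp: A_def)
    define x' where "x' t = (if t \<in> A then x t - m else x t)" for t
    have x0: "x t = 0" if "t \<in> M - A" for t
      using less.prems[of t] that by (force simp: A_def)
    have x'_nonneg: "0 \<le> x' t" if "t \<in> M" for t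
      using that less.prems m_le by (simp add: x'_def)
    have "{t\<in>M. x' t > 0} \<subset> A"
    proof
      show "{t\<in>M. x' t > 0} \<subseteq> A" by (auto simp: x'_def A_def split: if_splits)
      show "{t\<in>M. x' t > 0} \<noteq> A" using s by (auto simp: x'_def)
    qed
    then have card: "card {t\<in>M. x' t > 0} < card {t\<in>M. x t > 0}"
      using A(2) psubset_card_mono unfolding A_def[symmetric] by blast
    have Max: "(MAX t\<in>L. x t) = (MAX t\<in>L. x' t) + m * (if L \<inter> A \<noteq> {} then 1 else 0)"
      if "L \<in> Pow M - {{}}" for L
    proof (cases "L \<inter> A = {}")
      case True
      then have "x ` L = x' ` L" by (intro image_cong) (auto simp: x'_def)
      then show ?thesis using True by simp
    next
      case False
      have "(MAX t\<in>L. x t) = (MAX t\<in>L. x' t) + m"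
      proof (rule Max_eqI)
        show "finite (x ` L)" using fin[OF that] by simp
        have ge: "x' t \<le> (MAX t\<in>L. x' t)" if "t \<in> L" for t
          using that fin[OF \<open>L \<in> _\<close>] by simp
        show "v \<le> (MAX t\<in>L. x' t) + m" if "v \<in> x ` L" for v
        proof -
          obtain t where t: "t \<in> L" "v = x t" using \<open>v \<in> _\<close> by auto
          have "x t \<le> x' t + m" using m by (simp add: x'_def)
          then show ?thesis using ge[OF t(1)] t(2) by linarith
        qed
        have "(MAX t\<in>L. x' t) \<in> x' ` L" using fin[OF that] by (intro Max_in) auto
        then obtain t where t: "t \<in> L" "(MAX t\<in>L. x' t) = x' t" by auto
        show "(MAX t\<in>L. x' t) + m \<in> x ` L"
        proof (cases "t \<in> A")
          case True
          then show ?thesis using t by (auto simp: x'_def)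
        next
          case out: False
          then have "x' t = 0" using x0 t fin[OF that] by (auto simp: x'_def)
          obtain r where r: "r \<in> L" "r \<in> A" using False by auto
          then have "x' r \<le> 0" using ge[OF r(1)] t \<open>x' t = 0\<close> by simp
          then have "x r = m" using m_le[OF r(2)] r(2) by (simp add: x'_def)
          then show ?thesis using r t \<open>x' t = 0\<close> by force
        qed
      qed
      then show ?thesis using False by simp
    qed
    have "(\<Sum>t\<in>M. x t * y t) = (\<Sum>t\<in>M. x' t * y t + m * (if t \<in> A then y t else 0))"
      by (intro sum.cong) (auto simp: x'_def algebra_simps)
    also have "\<dots> = (\<Sum>t\<in>M. x' t * y t) + m * (\<Sum>t\<in>A. y t)"
      using A M by (simp add: sum.distrib flip: sum_distrib_left sum.inter_restrict)
        (simp add: Int_absorb1)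
    also have "\<dots> \<le> (\<Sum>L\<in>Pow M - {{}}. tau \<theta> M L * (MAX t\<in>L. x' t)) + m * \<theta> A"
      using m by (intro add_mono less.hyps[OF card x'_nonneg] mult_left_mono y A False) auto
    also have "m * \<theta> A = (\<Sum>L\<in>Pow M - {{}}. m * (tau \<theta> M L * (if L \<inter> A \<noteq> {} then 1 else 0)))"
      using sum_tau_meeting[where \<theta>=\<theta>, OF M A(1) \<theta>] by (simp only: flip: sum_distrib_left)
    also have "(\<Sum>L\<in>Pow M - {{}}. tau \<theta> M L * (MAX t\<in>L. x' t)) + \<dots> =
        (\<Sum>L\<in>Pow M - {{}}. tau \<theta> M L * (MAX t\<in>L. x t))"
      unfolding sum.distrib[symmetric]
      by (intro sum.cong) (auto simp only: Max algebra_simps)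
    finally show ?thesis .
  qed
qed

lemma scalar_prod_indicator_vec:
  assumes "finite M" "L \<subseteq> M"
  shows "scalar_prod M x (indicator_vec M L) = (\<Sum>t\<in>L. x t)"
proof -
  have "scalar_prod M x (indicator_vec M L) = (\<Sum>t\<in>M. if t \<in> L then x t else 0)"
    unfolding scalar_prod_def indicator_vec_def by (intro sum.cong) (auto simp: indicator_def)
  also have "\<dots> = (\<Sum>t\<in>L. x t)"
    using assms by (simp add: sum.inter_restrict[symmetric] Int_absorb1)
  finally show ?thesis .
qed

lemma stable_tail_dependence_restrict:
  "stable_tail_dependence P X M x =
     - ln (measure P {\<omega> \<in> space P. \<forall>t\<in>{t\<in>M. x t \<noteq> 0}. X t \<omega> \<le> 1 / x t})"
  unfolding stable_tail_dependence_def
  by (intro arg_cong[where f="\<lambda>A. - ln (measure P A)"]) auto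

lemma stable_tail_dependence_indicator_vec:
  assumes "L \<subseteq> M"
  shows "stable_tail_dependence P X M (indicator_vec M L) =
     - ln (measure P {\<omega> \<in> space P. \<forall>t\<in>L. X t \<omega> \<le> 1})"
  using assms unfolding stable_tail_dependence_def indicator_vec_def
  by (intro arg_cong[where f="\<lambda>A. - ln (measure P A)"]) (auto simp: indicator_def)

lemma extremal_coeff_altdef:
  assumes "finite L" "L \<noteq> {}"
  shows "extremal_coeff P X L = - ln (measure P {\<omega> \<in> space P. \<forall>t\<in>L. X t \<omega> \<le> 1})"
  using assms by (simp add: extremal_coeff_def)

lemma dependency_set_subset_half_spaces:
  assumes M: "finite M"
    and \<theta>: "\<And>L. L \<subseteq> M \<Longrightarrow> L \<noteq> {} \<Longrightarrow> stable_tail_dependence P X M (indicator_vec M L) = \<theta> L"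
  shows "dependency_set P X M \<subseteq> (\<Inter>L\<in>Pow M - {{}}. half_space \<theta> M L)"
proof (intro subsetI INT_I)
  fix y L assume y: "y \<in> dependency_set P X M" and "L \<in> Pow M - {{}}"
  then have L: "L \<subseteq> M" "L \<noteq> {}" by auto
  have "indicator_vec M L \<in> M \<rightarrow>\<^sub>E {0..}" by (auto simp: indicator_vec_def)
  then have "scalar_prod M (indicator_vec M L) y \<le> \<theta> L"
    using y \<theta>[OF L] by (force simp: dependency_set_def)
  then show "y \<in> half_space \<theta> M L"
    using y by (simp add: half_space_def dependency_set_def scalar_prod_def mult.commute)
qed

lemma dependency_set_associated_field:
  assumes af: "associated_field \<theta> Q T X" and M: "finite M" "M \<subseteq> T" and ne: "M \<noteq> {}" and \<theta>: "\<theta> {} = 0"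
  shows "dependency_set Q X M = (\<Inter>L\<in>Pow M - {{}}. half_space \<theta> M L)"
proof
  interpret prob_space Q using af by (simp add: associated_field_def random_field_def)
  have law: "measure Q {\<omega> \<in> space Q. \<forall>t\<in>F. X t \<omega> \<le> x t} =
      exp (- (\<Sum>L\<in>Pow F - {{}}. tau \<theta> F L * (MAX t\<in>L. 1 / x t)))"
    if "F \<subseteq> M" "F \<noteq> {}" "\<And>t. t \<in> F \<Longrightarrow> 0 < x t" for F x
  proof -
    have "finite F" "F \<subseteq> T" using that(1) M finite_subset by auto
    then show ?thesis using af that(2,3) unfolding associated_field_def by blast
  qed
  show "dependency_set Q X M \<subseteq> (\<Inter>L\<in>Pow M - {{}}. half_space \<theta> M L)"
  proof (rule dependency_set_subset_half_spaces[OF M(1)])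
    fix L assume L: "L \<subseteq> M" "L \<noteq> {}"
    then have fL: "finite L" using M finite_subset by auto
    have "stable_tail_dependence Q X M (indicator_vec M L) =
        (\<Sum>I\<in>Pow L - {{}}. tau \<theta> L I * (MAX t\<in>I. 1 / 1))"
      unfolding stable_tail_dependence_indicator_vec[OF L(1)] using law[OF L, of "\<lambda>_. 1"] by simp
    also have "\<dots> = (\<Sum>I\<in>Pow L - {{}}. tau \<theta> L I * (if I \<inter> L \<noteq> {} then 1 else 0))"
    proof (intro sum.cong)
      fix I assume I: "I \<in> Pow L - {{}}"
      then have "(\<lambda>t. 1 / 1 :: real) ` I = {1}" by auto
      then show "tau \<theta> L I * (MAX t\<in>I. 1 / 1) = tau \<theta> L I * (if I \<inter> L \<noteq> {} then 1 else 0)"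
        using I by (auto simp: Int_absorb2)
    qed simp
    also have "\<dots> = \<theta> L" by (rule sum_tau_meeting) (use fL \<theta> in auto)
    finally show "stable_tail_dependence Q X M (indicator_vec M L) = \<theta> L" .
  qed
  show "(\<Inter>L\<in>Pow M - {{}}. half_space \<theta> M L) \<subseteq> dependency_set Q X M"
  proof
    fix y assume y: "y \<in> (\<Inter>L\<in>Pow M - {{}}. half_space \<theta> M L)"
    have yL: "(\<Sum>t\<in>L. y t) \<le> \<theta> L" if "L \<subseteq> M" "L \<noteq> {}" for L
    proof -
      have "y \<in> half_space \<theta> M L" using y that by blast
      then show ?thesis by (simp add: half_space_def scalar_prod_indicator_vec[OF M(1) that(1)])
    qed
    have tail: "scalar_prod M x y \<le> stable_tail_dependence Q X M x" if x: "x \<in> M \<rightarrow>\<^sub>E {0..}" for x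
    proof -
      define F where "F = {t\<in>M. x t \<noteq> 0}"
      have F: "F \<subseteq> M" "finite F" using M by (auto simp: F_def)
      have pos: "0 < x t" if "t \<in> F" for t
        using that x by (force simp: F_def)
      have "scalar_prod M x y = (\<Sum>t\<in>F. x t * y t)"
        unfolding scalar_prod_def F_def using M by (intro sum.mono_neutral_right) auto
      also have "\<dots> \<le> (\<Sum>L\<in>Pow F - {{}}. tau \<theta> F L * (MAX t\<in>L. x t))"
        using yL F pos by (intro sum_le_tau_sum F \<theta>) (auto intro: less_imp_le)
      also have "\<dots> = - ln (measure Q {\<omega> \<in> space Q. \<forall>t\<in>F. X t \<omega> \<le> 1 / x t})"
      proof (cases "F = {}")
        case True
        then show ?thesis by (simp add: prob_space)
      next
        case False
        then show ?thesis using law[OF F(1) False, of "\<lambda>t. 1 / x t"] pos by simp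
      qed
      also have "\<dots> = stable_tail_dependence Q X M x"
        by (simp only: stable_tail_dependence_restrict F_def)
      finally show ?thesis .
    qed
    moreover have "y \<in> M \<rightarrow>\<^sub>E {0..}" using y ne by (auto simp: half_space_def)
    ultimately show "y \<in> dependency_set Q X M" by (simp add: dependency_set_def)
  qed
qed

section \<open>Frechet laws\<close>

lemma exp_inverse_law_of_power_scaling:
  fixes F :: "real \<Rightarrow> real"
  assumes mono: "\<And>x y. x \<le> y \<Longrightarrow> F x \<le> F y"
    and pow: "\<And>n x. n \<ge> 1 \<Longrightarrow> F x = F (real n * x) ^ n"
    and pos: "x0 > 0" "F x0 > 0"
    and r: "r > 0"
  shows "F r = exp (ln (F 1) / r)"
proof -
  have F_pos: "F x > 0" if "x > 0" for x
  proof -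
    obtain n where n: "real n * x > x0" using \<open>x > 0\<close> reals_Archimedean3 by blast
    then have "n \<ge> 1" using pos(1) by (cases n) auto
    have "F (real n * x) > 0" using mono[of x0 "real n * x"] n pos(2) by simp
    then show ?thesis using pow[OF \<open>n \<ge> 1\<close>, of x] by simp
  qed
  define k where "k s = - ln (F (1 / s))" for s
  have k_mono: "k s \<le> k s'" if "0 < s" "s \<le> s'" for s s'
    using mono[of "1 / s'" "1 / s"] F_pos[of "1 / s'"] F_pos[of "1 / s"] that
    by (simp add: k_def frac_le)
  have k_mult: "k (real n * s) = real n * k s" if "n \<ge> 1" "s > 0" for n s
    using pow[OF that(1), of "1 / (real n * s)"] F_pos[of "1 / s"] that
    by (simp add: k_def ln_realpow)
  have k_nonneg: "0 \<le> k s" if "s > 0" for s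
    using k_mono[of s "2 * s"] k_mult[of 2 s] that by simp
  have k_linear: "k s = s * k 1" if s: "s > 0" for s
  proof (rule ccontr)
    assume "k s \<noteq> s * k 1"
    then have "\<bar>k s - s * k 1\<bar> > 0" by simp
    then obtain b where b: "real b * \<bar>k s - s * k 1\<bar> > k 1" using reals_Archimedean3 by blast
    then have b1: "b \<ge> 1" using k_nonneg[of 1] by (cases b) auto
    define a where "a = nat \<lfloor>real b * s\<rfloor>"
    have a: "real a \<le> real b * s" "real b * s \<le> real (a + 1)"
    proof -
      have "real a = of_int \<lfloor>real b * s\<rfloor>" using s by (simp add: a_def)
      then show "real a \<le> real b * s" "real b * s \<le> real (a + 1)" by linarith+
    qed
    have lower: "real a * k 1 \<le> real b * k s"
    proof (cases "a = 0")
      case True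
      then show ?thesis using k_nonneg[OF s] by simp
    next
      case False
      then show ?thesis using k_mono[OF _ a(1)] k_mult[of a 1] k_mult[OF b1 s] by simp
    qed
    have upper: "real b * k s \<le> real (a + 1) * k 1"
      using k_mono[OF _ a(2)] k_mult[of "a + 1" 1] k_mult[OF b1 s] s b1 by simp
    have "(real b * s - 1) * k 1 \<le> real a * k 1" "real (a + 1) * k 1 \<le> (real b * s + 1) * k 1"
      using a k_nonneg[of 1] by (auto intro!: mult_right_mono)
    then have "\<bar>real b * k s - real b * (s * k 1)\<bar> \<le> k 1"
      using lower upper by (simp add: algebra_simps abs_le_iff)
    then show False using b by (simp add: abs_mult flip: right_diff_distrib)
  qed
  have "ln (F r) = ln (F 1) / r"
    using k_linear[of "1 / r"] r by (simp add: k_def)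
  then show ?thesis using F_pos[OF r] by (metis exp_ln)
qed

definition frechet_law :: "'w measure \<Rightarrow> ('w \<Rightarrow> real) \<Rightarrow> real \<Rightarrow> bool" where
  "frechet_law P Y s \<longleftrightarrow> Y \<in> borel_measurable P \<and> s > 0 \<and>
     (\<forall>r>0. measure P {\<omega> \<in> space P. Y \<omega> \<le> r} = exp (- s / r))"

context prob_space
begin

lemma frechet_law_nonpos:
  assumes Y: "frechet_law M Y s" and r: "r \<le> 0"
  shows "measure M {\<omega> \<in> space M. Y \<omega> \<le> r} = 0"
proof (rule ccontr)
  define p where "p = measure M {\<omega> \<in> space M. Y \<omega> \<le> r}"
  have [measurable]: "Y \<in> borel_measurable M" and s: "s > 0"
    using Y by (auto simp: frechet_law_def)
  assume "measure M {\<omega> \<in> space M. Y \<omega> \<le> r} \<noteq> 0"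
  then have p: "0 < p" "p \<le> 1"
    by (auto simp: p_def less_le)
  define r' where "r' = s / (1 - ln p)"
  have ln_p: "1 - ln p > 0" using p ln_le_minus_one[of p] by simp
  have "r' > 0" using s ln_p by (simp add: r'_def)
  then have "p \<le> measure M {\<omega> \<in> space M. Y \<omega> \<le> r'}"
    unfolding p_def using r by (intro finite_measure_mono) auto
  also have "\<dots> = exp (- s / r')" using Y \<open>r' > 0\<close> by (auto simp: frechet_law_def)
  also have "\<dots> = exp (ln p - 1)" using s ln_p by (simp add: r'_def)
  also have "\<dots> < exp (ln p)" by simp
  finally show False using p by simp
qed

lemma frechet_law_pos:
  assumes Y: "frechet_law M Y s"
  shows "AE \<omega> in M. Y \<omega> > 0"
proof -
  have [measurable]: "Y \<in> borel_measurable M"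
    using Y by (auto simp: frechet_law_def)
  have "AE \<omega> in M. \<not> Y \<omega> \<le> 0"
    using frechet_law_nonpos[OF Y order_refl]
    by (intro AE_I[of _ _ "{\<omega> \<in> space M. Y \<omega> \<le> 0}"]) (auto simp: emeasure_eq_measure)
  then show ?thesis by (simp add: not_le)
qed

lemma frechet_law_scale:
  assumes Y: "frechet_law M Y s" and c: "c > 0"
  shows "frechet_law M (\<lambda>\<omega>. c * Y \<omega>) (c * s)"
proof -
  have "measure M {\<omega> \<in> space M. c * Y \<omega> \<le> r} = exp (- (c * s) / r)" if "r > 0" for r
  proof -
    have "{\<omega> \<in> space M. c * Y \<omega> \<le> r} = {\<omega> \<in> space M. Y \<omega> \<le> r / c}"
      using c by (simp add: field_simps)
    then show ?thesis using Y c that by (simp add: frechet_law_def mult.commute)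
  qed
  then show ?thesis using Y c by (auto simp: frechet_law_def intro: borel_measurable_times)
qed

lemma frechet_law_distr_eq:
  assumes Y: "frechet_law M Y s" and Z: "frechet_law M Z s"
  shows "distr M borel Y = distr M borel Z"
proof (rule cdf_unique)
  have [measurable]: "Y \<in> borel_measurable M" "Z \<in> borel_measurable M"
    using Y Z by (auto simp: frechet_law_def)
  show "real_distribution (distr M borel Y)" "real_distribution (distr M borel Z)"
    by simp_all
  have "measure M {\<omega> \<in> space M. Y \<omega> \<le> r} = measure M {\<omega> \<in> space M. Z \<omega> \<le> r}" for r
    using frechet_law_nonpos[OF Y, of r] frechet_law_nonpos[OF Z, of r] Y Z
    by (cases "r > 0") (auto simp: frechet_law_def)
  then show "cdf (distr M borel Y) = cdf (distr M borel Z)"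
    by (intro ext) (simp add: cdf_def measure_distr vimage_def Int_def conj_commute)
qed

text \<open>
  The event \<open>2^k < Y\<close> has probability at most \<open>s / 2^k\<close>, so a dyadic decomposition bounds the moment by
  a geometric series of ratio \<open>2 powr (a - 1)\<close>.
\<close>

lemma frechet_law_integrable_powr:
  assumes Y: "frechet_law M Y s" and a: "0 < a" "a < 1"
  shows "integrable M (\<lambda>\<omega>. Y \<omega> powr a)"
proof -
  have Ym[measurable]: "Y \<in> borel_measurable M" and s: "s > 0"
    using Y by (auto simp: frechet_law_def)
  define q :: real where "q = 2 powr (a - 1)"
  have q: "0 < q" "q < 1" using a by (auto simp: q_def powr_less_one)
  define c :: real where "c = 2 powr a * s"
  let ?A = "\<lambda>k::nat. {\<omega> \<in> space M. 2 ^ k < Y \<omega>}"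
  let ?f = "\<lambda>k \<omega>. ennreal (2 powr (real (k + 1) * a)) * indicator (?A k) \<omega>"
  have tail: "measure M (?A k) \<le> s / 2 ^ k" for k
  proof -
    have "?A k = space M - {\<omega> \<in> space M. Y \<omega> \<le> 2 ^ k}" by auto
    then have "measure M (?A k) = 1 - exp (- s / 2 ^ k)"
      using Y by (simp add: prob_compl frechet_law_def)
    then show ?thesis using exp_ge_add_one_self[of "- s / 2 ^ k"] by simp
  qed
  have int_f: "(\<integral>\<^sup>+ \<omega>. ?f k \<omega> \<partial>M) \<le> ennreal (c * q ^ k)" for k
  proof -
    have "(\<integral>\<^sup>+ \<omega>. ?f k \<omega> \<partial>M) = ennreal (2 powr (real (k + 1) * a) * measure M (?A k))"
      by (simp add: nn_integral_cmult emeasure_eq_measure ennreal_mult)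
    also have "\<dots> \<le> ennreal (2 powr (real (k + 1) * a) * (s / 2 ^ k))"
      using tail by (intro ennreal_leI mult_left_mono) auto
    also have "2 powr (real (k + 1) * a) * (s / 2 ^ k) = c * q ^ k"
    proof -
      have "q ^ k = 2 powr (real k * a) / 2 ^ k"
        by (simp add: q_def powr_diff power_divide powr_power mult.commute)
      then show ?thesis by (simp add: c_def powr_add distrib_right)
    qed
    finally show ?thesis .
  qed
  have le_suminf: "g k \<le> suminf g" for g :: "nat \<Rightarrow> ennreal" and k
    using sum_le_suminf[of g "{k}"] by simp
  have bound: "AE \<omega> in M. ennreal (norm (Y \<omega> powr a)) \<le> 1 + (\<Sum>k. ?f k \<omega>)"
    using frechet_law_pos[OF Y] AE_space
  proof eventually_elim
    case (elim \<omega>)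
    show ?case
    proof (cases "Y \<omega> \<le> 1")
      case True
      then have "Y \<omega> powr a \<le> 1" using elim a powr_mono2[of a "Y \<omega>" 1] by simp
      then have "ennreal (norm (Y \<omega> powr a)) \<le> 1" by (simp flip: ennreal_1 del: ennreal_1 add: ennreal_le_iff)
      then show ?thesis by (rule order_trans) simp
    next
      case False
      define n where "n = (LEAST n. Y \<omega> \<le> 2 ^ n)"
      have "\<exists>n. Y \<omega> \<le> 2 ^ n" using real_arch_pow[of 2 "Y \<omega>"] by (auto intro: less_imp_le)
      then have n: "Y \<omega> \<le> 2 ^ n" unfolding n_def by (rule LeastI_ex)
      then obtain k where k: "n = Suc k" using False by (cases n) auto
      have "\<not> Y \<omega> \<le> 2 ^ k" using not_less_Least[of k "\<lambda>n. Y \<omega> \<le> 2 ^ n"] k by (simp add: n_def)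
      then have "\<omega> \<in> ?A k" using elim by simp
      have "Y \<omega> powr a \<le> (2 powr real (k + 1)) powr a"
        using n k elim a by (intro powr_mono2) (auto simp: powr_realpow powr_add)
      then have "ennreal (norm (Y \<omega> powr a)) \<le> ?f k \<omega>"
        using \<open>\<omega> \<in> ?A k\<close> by (simp add: powr_powr ennreal_leI)
      also have "\<dots> \<le> (\<Sum>k. ?f k \<omega>)"
        by (rule le_suminf)
      also have "\<dots> \<le> 1 + (\<Sum>k. ?f k \<omega>)" by simp
      finally show ?thesis .
    qed
  qed
  have "(\<integral>\<^sup>+ \<omega>. ennreal (norm (Y \<omega> powr a)) \<partial>M) \<le> (\<integral>\<^sup>+ \<omega>. 1 + (\<Sum>k. ?f k \<omega>) \<partial>M)"
    by (rule nn_integral_mono_AE[OF bound])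
  also have "\<dots> = 1 + (\<Sum>k. \<integral>\<^sup>+ \<omega>. ?f k \<omega> \<partial>M)"
    by (simp add: nn_integral_add nn_integral_suminf emeasure_space_1)
  also have "\<dots> \<le> 1 + (\<Sum>k. ennreal (c * q ^ k))"
    by (intro add_left_mono suminf_le int_f) auto
  also have "\<dots> = 1 + ennreal (\<Sum>k. c * q ^ k)"
    using q s by (subst suminf_ennreal2) (auto simp: c_def intro!: summable_mult)
  also have "\<dots> < \<infinity>" by (simp add: ennreal_add_eq_top less_top)
  finally show ?thesis by (simp add: integrable_iff_bounded)
qed

lemma frechet_law_moment:
  assumes Y: "frechet_law M Y s" and Z: "frechet_law M Z 1"
  shows "expectation (\<lambda>\<omega>. Y \<omega> powr a) = s powr a * expectation (\<lambda>\<omega>. Z \<omega> powr a)"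
proof -
  have [measurable]: "Y \<in> borel_measurable M" "Z \<in> borel_measurable M" and s: "s > 0"
    using Y Z by (auto simp: frechet_law_def)
  have "expectation (\<lambda>\<omega>. Y \<omega> powr a) = (\<integral>x. x powr a \<partial>distr M borel Y)"
    by (simp add: integral_distr)
  also have "distr M borel Y = distr M borel (\<lambda>\<omega>. s * Z \<omega>)"
    using frechet_law_distr_eq[OF Y] frechet_law_scale[OF Z s] by simp
  also have "(\<integral>x. x powr a \<partial>\<dots>) = expectation (\<lambda>\<omega>. (s * Z \<omega>) powr a)"
    by (simp add: integral_distr)
  finally show ?thesis by (simp add: powr_mult)
qed

lemma frechet_law_moment_pos:
  assumes Y: "frechet_law M Y s" and a: "0 < a" "a < 1"
  shows "expectation (\<lambda>\<omega>. Y \<omega> powr a) > 0"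
proof -
  have "expectation (\<lambda>\<omega>. Y \<omega> powr a) \<noteq> 0"
  proof
    assume "expectation (\<lambda>\<omega>. Y \<omega> powr a) = 0"
    then have "AE \<omega> in M. Y \<omega> powr a = 0"
      using integral_nonneg_eq_0_iff_AE[OF frechet_law_integrable_powr[OF Y a]] by simp
    then have "AE \<omega> in M. False"
      using frechet_law_pos[OF Y] by eventually_elim simp
    then show False by simp
  qed
  moreover have "expectation (\<lambda>\<omega>. Y \<omega> powr a) \<ge> 0" by (simp add: Bochner_Integration.integral_nonneg)
  ultimately show ?thesis by linarith
qed

end

lemma frechet_law_weighted_max:
  fixes X :: "'t \<Rightarrow> 'w \<Rightarrow> real"
  assumes rf: "random_field P T X" and ms: "max_stable P T X"
    and fr: "standard_frechet_marginals P T X"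
    and F: "finite F" "F \<noteq> {}" "F \<subseteq> T" and u: "\<And>t. t \<in> F \<Longrightarrow> 0 < u t"
  shows "frechet_law P (\<lambda>\<omega>. MAX t\<in>F. u t * X t \<omega>)
    (- ln (measure P {\<omega> \<in> space P. \<forall>t\<in>F. X t \<omega> \<le> 1 / u t}))"
proof -
  interpret prob_space P using rf by (simp add: random_field_def)
  have X[measurable]: "X t \<in> borel_measurable P" if "t \<in> F" for t
    using rf that F by (auto simp: random_field_def)
  define G where "G r = measure P {\<omega> \<in> space P. \<forall>t\<in>F. X t \<omega> \<le> r / u t}" for r
  have sets: "{\<omega> \<in> space P. \<forall>t\<in>F. X t \<omega> \<le> c t} \<in> sets P" for c :: "'t \<Rightarrow> real"
    using F by (auto intro!: sets.sets_Collect_finite_All borel_measurable_le)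
  have mono: "G x \<le> G y" if "x \<le> y" for x y
    unfolding G_def
  proof (intro finite_measure_mono sets subsetI CollectI conjI ballI)
    fix \<omega> t assume \<omega>: "\<omega> \<in> {\<omega> \<in> space P. \<forall>t\<in>F. X t \<omega> \<le> x / u t}" and t: "t \<in> F"
    have "x / u t \<le> y / u t" using that u[OF t] by (simp add: divide_right_mono)
    then show "X t \<omega> \<le> y / u t" using \<omega> t by fastforce
  qed auto
  have pow: "G x = G (real n * x) ^ n" if "n \<ge> 1" for n x
    using max_stable_prob_le[OF rf ms F(1,3) that, of "\<lambda>t. x / u t"] by (simp add: G_def)
  have marg: "measure P {\<omega> \<in> space P. X t \<omega> \<le> r / u t} = exp (- u t / r)" if "t \<in> F" "r > 0" for t r
    using fr F u[OF that(1)] that by (auto simp: standard_frechet_marginals_def)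
  define x0 where "x0 = (\<Sum>t\<in>F. u t) + 1"
  have "(\<Sum>t\<in>F. u t) \<ge> 0" using u by (auto intro: sum_nonneg less_imp_le)
  then have x0: "x0 > 0" by (simp add: x0_def)
  have G_x0: "G x0 > 0"
  proof -
    have eq: "{\<omega> \<in> space P. \<forall>t\<in>F. X t \<omega> \<le> x0 / u t} =
        space P - (\<Union>t\<in>F. {\<omega> \<in> space P. \<not> X t \<omega> \<le> x0 / u t})"
      by auto
    have ev: "(\<lambda>t. {\<omega> \<in> space P. \<not> X t \<omega> \<le> x0 / u t}) ` F \<subseteq> sets P" by auto
    have "measure P (\<Union>t\<in>F. {\<omega> \<in> space P. \<not> X t \<omega> \<le> x0 / u t})
        \<le> (\<Sum>t\<in>F. measure P {\<omega> \<in> space P. \<not> X t \<omega> \<le> x0 / u t})"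
      by (rule finite_measure_subadditive_finite[OF F(1) ev])
    also have "\<dots> \<le> (\<Sum>t\<in>F. u t / x0)"
    proof (rule sum_mono)
      fix t assume t: "t \<in> F"
      have "measure P {\<omega> \<in> space P. \<not> X t \<omega> \<le> x0 / u t} = 1 - exp (- u t / x0)"
        using marg[OF t x0] X[OF t] by (subst prob_neg) auto
      then show "measure P {\<omega> \<in> space P. \<not> X t \<omega> \<le> x0 / u t} \<le> u t / x0"
        using exp_ge_add_one_self[of "- u t / x0"] by simp
    qed
    also have "\<dots> < 1" using x0 by (simp add: x0_def flip: sum_divide_distrib)
    finally show ?thesis
      unfolding G_def eq using ev F(1) by (subst prob_compl) (auto intro!: sets.finite_UN)
  qed
  have law: "G r = exp (ln (G 1) / r)" if "r > 0" for r
    by (rule exp_inverse_law_of_power_scaling[where F=G, OF mono pow x0 G_x0 that])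
  have "G 1 < 1"
  proof -
    obtain t where t: "t \<in> F" using F by auto
    have "G 1 \<le> measure P {\<omega> \<in> space P. X t \<omega> \<le> 1 / u t}"
      unfolding G_def using t X[OF t] by (intro finite_measure_mono) auto
    also have "\<dots> < 1" using marg[OF t, of 1] u[OF t] by simp
    finally show ?thesis .
  qed
  moreover have "G 1 > 0" using law[of 1] by (metis exp_gt_zero zero_less_one)
  moreover have "measure P {\<omega> \<in> space P. (MAX t\<in>F. u t * X t \<omega>) \<le> r} = G r" for r
    using F u by (auto simp: G_def pos_le_divide_eq mult.commute intro!: arg_cong[where f="measure P"])
  moreover have "exp (ln (G 1) / r) = exp (- (- ln (G 1)) / r)" for r by simp
  moreover have "(\<lambda>\<omega>. MAX t\<in>F. u t * X t \<omega>) \<in> borel_measurable P"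
    using F(1) by (intro borel_measurable_Max borel_measurable_times X) auto
  ultimately show ?thesis
    unfolding frechet_law_def G_def[of 1, symmetric] by (metis law ln_less_zero neg_0_less_iff_less)
qed

lemma pointwise_convergent_subsequence:
  fixes f :: "nat \<Rightarrow> 't \<Rightarrow> real"
  assumes "finite M" "\<And>t. t \<in> M \<Longrightarrow> bounded (range (\<lambda>n. f n t))"
  obtains r :: "nat \<Rightarrow> nat" and l where "strict_mono r" "\<And>t. t \<in> M \<Longrightarrow> (\<lambda>n. f (r n) t) \<longlonglongrightarrow> l t"
  using assms
proof (induction M arbitrary: thesis)
  case empty
  show ?case by (rule empty(1)[of id]) (auto simp: strict_mono_def)
next
  case (insert s M)
  obtain r1 l1 where r1: "strict_mono r1" "\<And>t. t \<in> M \<Longrightarrow> (\<lambda>n. f (r1 n) t) \<longlonglongrightarrow> l1 t"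
    using insert.IH insert.prems(2) by (metis insertCI)
  have "bounded (range (\<lambda>n. f (r1 n) s))"
    by (rule bounded_subset[OF insert.prems(2)[of s]]) auto
  from bounded_imp_convergent_subsequence[OF this]
  obtain c r2 where r2: "strict_mono r2" "(\<lambda>n. f (r1 (r2 n)) s) \<longlonglongrightarrow> c" by (auto simp: o_def)
  show ?case
  proof (rule insert.prems(1)[of "r1 \<circ> r2" "l1(s := c)"])
    show "strict_mono (r1 \<circ> r2)" using r1(1) r2(1) by (rule strict_mono_o)
    show "(\<lambda>n. f ((r1 \<circ> r2) n) t) \<longlonglongrightarrow> (l1(s := c)) t" if "t \<in> insert s M" for t
      using that r2(2) LIMSEQ_subseq_LIMSEQ[OF r1(2) r2(1), of t] by (auto simp: o_def)
  qed
qed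

section \<open>Points on the bounding planes\<close>

lemma frechet_law_stable_tail_dependence:
  assumes "random_field P T X" "max_stable P T X" "standard_frechet_marginals P T X"
    and M: "finite M" "M \<subseteq> T" and u: "\<And>t. t \<in> M \<Longrightarrow> 0 \<le> u t" and ne: "{t\<in>M. u t \<noteq> 0} \<noteq> {}"
  shows "frechet_law P (\<lambda>\<omega>. MAX t\<in>{t\<in>M. u t \<noteq> 0}. u t * X t \<omega>) (stable_tail_dependence P X M u)"
  unfolding stable_tail_dependence_restrict
proof (rule frechet_law_weighted_max[OF assms(1-3)])
  show "0 < u t" if "t \<in> {t\<in>M. u t \<noteq> 0}" for t using u[of t] that by auto
qed (use M ne in auto)

lemma approximate_support_point:
  fixes X :: "'t \<Rightarrow> 'w \<Rightarrow> real"
  assumes rf: "random_field P T X" and ms: "max_stable P T X"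
    and fr: "standard_frechet_marginals P T X"
    and M: "finite M" "M \<subseteq> T" and L: "L \<noteq> {}" "L \<subseteq> M" and a: "0 < a" "a < 1"
  obtains y where "\<And>t. 0 \<le> y t" "\<And>t. t \<notin> L \<Longrightarrow> y t = 0"
    "(\<Sum>t\<in>L. y t) = extremal_coeff P X L powr a"
    "\<And>u C. (\<And>t. t \<in> M \<Longrightarrow> 0 \<le> u t \<and> u t \<le> C) \<Longrightarrow>
      (\<Sum>t\<in>M. u t * y t) \<le> C powr (1 - a) * stable_tail_dependence P X M u powr a"
proof -
  interpret prob_space P using rf by (simp add: random_field_def)
  have fL: "finite L" using L M finite_subset by auto
  have X: "X t \<in> borel_measurable P" if "t \<in> M" for t
    using rf that M by (auto simp: random_field_def)
  have lawX: "frechet_law P (X t) 1" if "t \<in> M" for t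
    using X[OF that] fr that M by (auto simp: frechet_law_def standard_frechet_marginals_def)
  define V where "V \<omega> = (MAX t\<in>L. X t \<omega>)" for \<omega>
  have lawV: "frechet_law P V (extremal_coeff P X L)"
    using frechet_law_weighted_max[OF rf ms fr fL L(1), of "\<lambda>_. 1"] L(2) M(2)
    by (auto simp: V_def[abs_def] extremal_coeff_altdef[OF fL L(1)])
  then have [measurable]: "V \<in> borel_measurable P" by (simp add: frechet_law_def)
  obtain s where s: "s \<in> L" using L by auto
  define c where "c = expectation (\<lambda>\<omega>. X s \<omega> powr a)"
  have c: "c > 0" unfolding c_def using s L by (intro frechet_law_moment_pos[OF lawX a]) auto
  have moment: "expectation (\<lambda>\<omega>. Y \<omega> powr a) = r powr a * c" if "frechet_law P Y r" for Y r
    unfolding c_def using s L by (intro frechet_law_moment[OF that lawX]) auto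
  define N where "N \<omega> = (\<Sum>t\<in>L. indicator {\<omega>. X t \<omega> = V \<omega>} \<omega> :: real)" for \<omega>
  define w where "w t \<omega> = indicator {\<omega>. X t \<omega> = V \<omega>} \<omega> / N \<omega>" for t \<omega>
  have N_pos: "N \<omega> > 0" for \<omega>
  proof -
    have "V \<omega> \<in> (\<lambda>t. X t \<omega>) ` L" unfolding V_def using fL L by (intro Max_in) auto
    then obtain t where "t \<in> L" "X t \<omega> = V \<omega>" by auto
    then show ?thesis unfolding N_def using fL by (intro sum_pos2[of _ t]) auto
  qed
  have w_nonneg: "0 \<le> w t \<omega>" for t \<omega>
    using N_pos[of \<omega>] by (simp add: w_def)
  have w_sum: "(\<Sum>t\<in>L. w t \<omega>) = 1" for \<omega>
    using N_pos[of \<omega>] by (simp add: w_def N_def flip: sum_divide_distrib)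
  have w_le: "w t \<omega> \<le> 1" if "t \<in> L" for t \<omega>
    using member_le_sum[OF that, of "\<lambda>t. w t \<omega>"] w_nonneg fL by (simp add: w_sum)
  have ind: "(\<lambda>\<omega>. indicator {\<omega>. X t \<omega> = V \<omega>} \<omega> :: real) \<in> borel_measurable P" if "t \<in> L" for t
  proof -
    have [measurable]: "X t \<in> borel_measurable P" using X that L by auto
    have "(\<lambda>\<omega>. if X t \<omega> = V \<omega> then 1 else 0 :: real) \<in> borel_measurable P" by measurable
    then show ?thesis by (simp add: indicator_def)
  qed
  have w_meas: "w t \<in> borel_measurable P" if "t \<in> L" for t
    unfolding w_def N_def using ind that by (intro borel_measurable_divide borel_measurable_sum) auto
  have int: "integrable P (\<lambda>\<omega>. w t \<omega> * X t \<omega> powr a)" if t: "t \<in> L" for t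
  proof (rule Bochner_Integration.integrable_bound)
    show "integrable P (\<lambda>\<omega>. X t \<omega> powr a)"
      using t L by (intro frechet_law_integrable_powr[OF lawX a]) auto
    show "(\<lambda>\<omega>. w t \<omega> * X t \<omega> powr a) \<in> borel_measurable P"
    proof -
      have [measurable]: "X t \<in> borel_measurable P" "w t \<in> borel_measurable P"
        using X w_meas t L by auto
      show ?thesis by measurable
    qed
    show "AE \<omega> in P. norm (w t \<omega> * X t \<omega> powr a) \<le> norm (X t \<omega> powr a)"
      using w_le[OF t] w_nonneg by (auto simp: abs_mult intro!: mult_left_le_one_le)
  qed
  define y where "y t = (if t \<in> L then expectation (\<lambda>\<omega>. w t \<omega> * X t \<omega> powr a) / c else 0)" for t
  show ?thesis
  proof (rule that)
    show "0 \<le> y t" for t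
      using c w_nonneg by (auto simp: y_def intro!: divide_nonneg_pos Bochner_Integration.integral_nonneg)
    show "y t = 0" if "t \<notin> L" for t using that by (simp add: y_def)
    have "(\<Sum>t\<in>L. y t) = expectation (\<lambda>\<omega>. \<Sum>t\<in>L. w t \<omega> * X t \<omega> powr a) / c"
      using int by (simp add: y_def flip: sum_divide_distrib)
    also have "(\<lambda>\<omega>. \<Sum>t\<in>L. w t \<omega> * X t \<omega> powr a) = (\<lambda>\<omega>. V \<omega> powr a)"
    proof
      fix \<omega>
      have "(\<Sum>t\<in>L. w t \<omega> * X t \<omega> powr a) = (\<Sum>t\<in>L. w t \<omega> * V \<omega> powr a)"
        by (intro sum.cong) (auto simp: w_def indicator_def)
      then show "(\<Sum>t\<in>L. w t \<omega> * X t \<omega> powr a) = V \<omega> powr a"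
        using w_sum[of \<omega>] by (simp flip: sum_distrib_right)
    qed
    finally show "(\<Sum>t\<in>L. y t) = extremal_coeff P X L powr a"
      using c moment[OF lawV] by simp
    fix u :: "'t \<Rightarrow> real" and C :: real
    assume u: "\<And>t. t \<in> M \<Longrightarrow> 0 \<le> u t \<and> u t \<le> C"
    define F where "F = {t\<in>M. u t \<noteq> 0}"
    show "(\<Sum>t\<in>M. u t * y t) \<le> C powr (1 - a) * stable_tail_dependence P X M u powr a"
    proof (cases "F = {}")
      case True
      then have "(\<Sum>t\<in>M. u t * y t) = 0" by (intro sum.neutral) (auto simp: F_def)
      then show ?thesis by simp
    next
      case False
      define Y where "Y \<omega> = (MAX t\<in>F. u t * X t \<omega>)" for \<omega>
      have lawY: "frechet_law P Y (stable_tail_dependence P X M u)"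
        unfolding Y_def F_def using u False
        by (intro frechet_law_stable_tail_dependence[OF rf ms fr M]) (auto simp: F_def)
      have intY: "integrable P (\<lambda>\<omega>. C powr (1 - a) * Y \<omega> powr a)"
        using frechet_law_integrable_powr[OF lawY a] by simp
      have "(\<Sum>t\<in>M. u t * y t) = (\<Sum>t\<in>L. u t * y t)"
        using M L by (intro sum.mono_neutral_right) (auto simp: y_def)
      also have "\<dots> = expectation (\<lambda>\<omega>. \<Sum>t\<in>L. u t * (w t \<omega> * X t \<omega> powr a)) / c"
        using int by (simp add: y_def sum_divide_distrib)
      also have "expectation (\<lambda>\<omega>. \<Sum>t\<in>L. u t * (w t \<omega> * X t \<omega> powr a))
          \<le> expectation (\<lambda>\<omega>. C powr (1 - a) * Y \<omega> powr a)"
      proof (rule integral_mono_AE[OF _ intY])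
        show "integrable P (\<lambda>\<omega>. \<Sum>t\<in>L. u t * (w t \<omega> * X t \<omega> powr a))" using int by simp
        have "AE \<omega> in P. \<forall>t\<in>L. X t \<omega> > 0"
          using frechet_law_pos[OF lawX] L fL by (simp add: AE_ball_countable countable_finite subset_iff)
        then show "AE \<omega> in P. (\<Sum>t\<in>L. u t * (w t \<omega> * X t \<omega> powr a)) \<le> C powr (1 - a) * Y \<omega> powr a"
        proof eventually_elim
          case (elim \<omega>)
          have "u t * X t \<omega> powr a \<le> C powr (1 - a) * Y \<omega> powr a" if t: "t \<in> L" for t
          proof (cases "u t = 0")
            case False
            have tM: "t \<in> M" using t L by auto
            then have ut: "0 < u t" "u t \<le> C" using u[of t] False by auto
            have "u t * X t \<omega> \<le> Y \<omega>"
              unfolding Y_def using M tM False by (intro Max_ge) (auto simp: F_def)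
            moreover have "0 < X t \<omega>" using elim t by auto
            ultimately have "u t powr (1 - a) * (u t * X t \<omega>) powr a \<le> C powr (1 - a) * Y \<omega> powr a"
              using ut a by (intro mult_mono powr_mono2) auto
            moreover have "u t powr (1 - a) * (u t * X t \<omega>) powr a = u t * X t \<omega> powr a"
              using ut by (simp add: powr_mult powr_diff)
            ultimately show ?thesis by simp
          qed simp
          then have "(\<Sum>t\<in>L. w t \<omega> * (u t * X t \<omega> powr a)) \<le> (\<Sum>t\<in>L. w t \<omega> * (C powr (1 - a) * Y \<omega> powr a))"
            using w_nonneg by (intro sum_mono mult_left_mono) auto
          also have "\<dots> = C powr (1 - a) * Y \<omega> powr a"
            using w_sum[of \<omega>] by (simp flip: sum_distrib_right)
          finally show ?case by (simp add: mult.left_commute)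
        qed
      qed
      also have "\<dots> = C powr (1 - a) * stable_tail_dependence P X M u powr a * c"
        by (simp add: moment[OF lawY])
      finally show ?thesis using c by (simp add: divide_right_mono)
    qed
  qed
qed

lemma support_point_indicator_vec:
  fixes X :: "'t \<Rightarrow> 'w \<Rightarrow> real"
  assumes rf: "random_field P T X" and ms: "max_stable P T X"
    and fr: "standard_frechet_marginals P T X"
    and M: "finite M" "M \<subseteq> T" and L: "L \<noteq> {}" "L \<subseteq> M"
  shows "\<exists>x\<in>dependency_set P X M. scalar_prod M x (indicator_vec M L) = extremal_coeff P X L"
proof -
  let ?\<theta> = "extremal_coeff P X L" and ?\<l> = "stable_tail_dependence P X M"
  define a :: "nat \<Rightarrow> real" where "a n = 1 - inverse (real (n + 2))" for n
  have a: "0 < a n" "a n < 1" for n by (auto simp: a_def field_simps)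
  have a_lim: "a \<longlonglongrightarrow> 1"
    using tendsto_diff[OF tendsto_const[of "1::real"] LIMSEQ_ignore_initial_segment[OF lim_inverse_n, of 2]]
    by (simp add: a_def[abs_def])
  have "\<exists>y. (\<forall>t. 0 \<le> y t) \<and> (\<forall>t. t \<notin> L \<longrightarrow> y t = 0) \<and> (\<Sum>t\<in>L. y t) = ?\<theta> powr a n \<and>
      (\<forall>u C. (\<forall>t\<in>M. 0 \<le> u t \<and> u t \<le> C) \<longrightarrow>
        (\<Sum>t\<in>M. u t * y t) \<le> C powr (1 - a n) * ?\<l> u powr a n)" for n
    by (rule approximate_support_point[OF rf ms fr M L a, of n]) blast
  then obtain y where y: "\<And>n t. 0 \<le> y n t" "\<And>n t. t \<notin> L \<Longrightarrow> y n t = 0"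
      "\<And>n. (\<Sum>t\<in>L. y n t) = ?\<theta> powr a n"
      "\<And>n u C. (\<And>t. t \<in> M \<Longrightarrow> 0 \<le> u t \<and> u t \<le> C) \<Longrightarrow>
        (\<Sum>t\<in>M. u t * y n t) \<le> C powr (1 - a n) * ?\<l> u powr a n"
    by metis
  interpret prob_space P using rf by (simp add: random_field_def)
  have fL: "finite L" using L M finite_subset by auto
  have \<theta>_pos: "?\<theta> > 0"
    using frechet_law_weighted_max[OF rf ms fr fL L(1), of "\<lambda>_. 1"] L(2) M(2)
    by (simp add: extremal_coeff_altdef[OF fL L(1)] frechet_law_def subset_trans)
  have pow_lim: "(\<lambda>n. ?\<theta> powr a n) \<longlonglongrightarrow> ?\<theta>"
    using tendsto_powr[OF tendsto_const[of ?\<theta>] a_lim] \<theta>_pos by simp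
  obtain B where B: "\<And>n. ?\<theta> powr a n \<le> B"
    using convergent_imp_Bseq[OF convergentI[OF pow_lim]] by (auto simp: Bseq_def)
  have bdd: "bounded (range (\<lambda>n. y n t))" for t
  proof -
    have "y n t \<le> B" for n
    proof (cases "t \<in> L")
      case True
      then have "y n t \<le> (\<Sum>t\<in>L. y n t)" using y(1) fL by (intro member_le_sum) auto
      then show ?thesis using y(3)[of n] B[of n] by simp
    next
      case False
      then show ?thesis using y(2) B[of n] powr_ge_zero[of ?\<theta> "a n"] by (simp del: powr_ge_zero)
    qed
    then show ?thesis using y(1) by (intro boundedI[of _ B]) auto
  qed
  obtain r l where r: "strict_mono r" and l: "\<And>t. t \<in> M \<Longrightarrow> (\<lambda>n. y (r n) t) \<longlonglongrightarrow> l t"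
    by (rule pointwise_convergent_subsequence[where f=y, OF M(1) bdd]) blast
  have ar: "(\<lambda>n. a (r n)) \<longlonglongrightarrow> 1" using LIMSEQ_subseq_LIMSEQ[OF a_lim r] by (simp add: o_def)
  have sum_lim: "(\<lambda>n. \<Sum>t\<in>K. u t * y (r n) t) \<longlonglongrightarrow> (\<Sum>t\<in>K. u t * l t)" if "K \<subseteq> M" for K and u :: "'t \<Rightarrow> real"
    using that l by (intro tendsto_sum tendsto_mult tendsto_const) auto
  have l_nonneg: "0 \<le> l t" if "t \<in> M" for t
    by (rule LIMSEQ_le_const[OF l[OF that]]) (use y(1) in auto)
  have l_sum: "(\<Sum>t\<in>L. l t) = ?\<theta>"
  proof (rule LIMSEQ_unique)
    show "(\<lambda>n. \<Sum>t\<in>L. y (r n) t) \<longlonglongrightarrow> (\<Sum>t\<in>L. l t)" using sum_lim[OF L(2), of "\<lambda>_. 1"] by simp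
    show "(\<lambda>n. \<Sum>t\<in>L. y (r n) t) \<longlonglongrightarrow> ?\<theta>"
      using LIMSEQ_subseq_LIMSEQ[OF pow_lim r] by (simp add: y(3) o_def)
  qed
  have l_le: "(\<Sum>t\<in>M. u t * l t) \<le> ?\<l> u" if u: "\<And>t. t \<in> M \<Longrightarrow> 0 \<le> u t" for u
  proof (cases "\<forall>t\<in>M. u t = 0")
    case True
    then show ?thesis by (simp add: stable_tail_dependence_def prob_space)
  next
    case False
    then have "?\<l> u > 0"
      using frechet_law_stable_tail_dependence[OF rf ms fr M, of u] u by (auto simp: frechet_law_def)
    obtain s where s: "s \<in> M" "u s \<noteq> 0" using False by auto
    define C where "C = (\<Sum>t\<in>M. u t)"
    have C: "u t \<le> C" if "t \<in> M" for t
      unfolding C_def using that u M by (intro member_le_sum) auto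
    have "C > 0" using C[OF s(1)] u[OF s(1)] s(2) by simp
    have "(\<lambda>n. C powr (1 - a (r n)) * ?\<l> u powr a (r n)) \<longlonglongrightarrow> C powr (1 - 1) * ?\<l> u powr 1"
      using \<open>C > 0\<close> \<open>?\<l> u > 0\<close> by (intro tendsto_intros ar) auto
    then have "(\<lambda>n. C powr (1 - a (r n)) * ?\<l> u powr a (r n)) \<longlonglongrightarrow> ?\<l> u"
      using \<open>C > 0\<close> \<open>?\<l> u > 0\<close> by simp
    then show ?thesis
      by (rule LIMSEQ_le[OF sum_lim[OF order_refl]]) (use y(4) u C in auto)
  qed
  let ?x = "\<lambda>t\<in>M. l t"
  have "?x \<in> dependency_set P X M"
    using l_nonneg l_le by (auto simp: dependency_set_def scalar_prod_def PiE_iff)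
  moreover have "scalar_prod M ?x (indicator_vec M L) = ?\<theta>"
    using l_sum L by (auto simp: scalar_prod_indicator_vec[OF M(1) L(2)] subset_iff intro: sum.cong)
  ultimately show ?thesis by blast
qed

theorem theorem12:
  fixes P :: "'w measure" and T :: "'t set" and X :: "'t \<Rightarrow> 'w \<Rightarrow> real"
    and \<theta> :: "'t set \<Rightarrow> real" and M :: "'t set"
  assumes "random_field P T X"
    and "max_stable P T X"
    and "standard_frechet_marginals P T X"
    and "\<theta> = extremal_coeff P X"
    and "finite M" and "M \<noteq> {}" and "M \<subseteq> T"
  shows "dependency_set P X M \<subseteq> (\<Inter>L\<in>Pow M - {{}}. half_space \<theta> M L) \<and>
    (\<forall>L. L \<noteq> {} \<and> L \<subseteq> M \<longrightarrow>
       (\<exists>x \<in> dependency_set P X M. scalar_prod M x (indicator_vec M L) = \<theta> L)) \<and>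
    (\<forall>(Q :: 'v measure) Xs. associated_field \<theta> Q T Xs \<longrightarrow>
       dependency_set Q Xs M = (\<Inter>L\<in>Pow M - {{}}. half_space \<theta> M L))"
proof (intro conjI allI impI)
  show "dependency_set P X M \<subseteq> (\<Inter>L\<in>Pow M - {{}}. half_space \<theta> M L)"
  proof (rule dependency_set_subset_half_spaces[OF \<open>finite M\<close>])
    fix L assume L: "L \<subseteq> M" "L \<noteq> {}"
    then show "stable_tail_dependence P X M (indicator_vec M L) = \<theta> L"
      using finite_subset[OF L(1) \<open>finite M\<close>]
      by (simp add: stable_tail_dependence_indicator_vec extremal_coeff_altdef \<open>\<theta> = _\<close>)
  qed
  show "\<exists>x \<in> dependency_set P X M. scalar_prod M x (indicator_vec M L) = \<theta> L"
    if "L \<noteq> {} \<and> L \<subseteq> M" for L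
    unfolding \<open>\<theta> = _\<close> using that
    by (intro support_point_indicator_vec[OF assms(1-3) \<open>finite M\<close> \<open>M \<subseteq> T\<close>]) auto
  show "dependency_set Q Xs M = (\<Inter>L\<in>Pow M - {{}}. half_space \<theta> M L)"
    if "associated_field \<theta> Q T Xs" for Q :: "'v measure" and Xs
    by (rule dependency_set_associated_field[OF that \<open>finite M\<close> \<open>M \<subseteq> T\<close> \<open>M \<noteq> {}\<close>])
      (simp add: \<open>\<theta> = _\<close> extremal_coeff_def)
qed

end
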